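(* Let $F=(F,\mathcal T,\nu,\mathcal G)$ be a $\nu$-semifield$^\dagger$, $\Lambda=\{\lambda_1,\dots,\lambda_n\}$, and let $f=\frac hg\in\overline{F(\Lambda)}$. Put $$\Phi_{CI}(f)=|f|\wedge\bigl(|f^*+1|+\tilde h\bigr)\wedge\bigl(|f+1|+\tilde g\bigr).$$ Then the $\nu$-kernel $\langle\Phi_{CI}(f)\rangle$ is corner internal, and $1_{\mathrm{loc}}(\Phi_{CI}(f))\supseteq 1_{\mathrm{loc}}(f)$. Furthermore, $1_{\mathrm{loc}}(\Phi_{CI}(f))=1_{\mathrm{loc}}(f)$ if and only if $f$ is corner internal.
   Context: **$\nu$-structures.** A semiring$^\dagger$ is a commutative semiring with unit $1$, not required to have a zero (and containing $r_0,r_1$ with $r_0+r_1=1$). A $\nu$-domain$^\dagger$ is a quadruple $(R,\mathcal T,\nu,\mathcal G)$ with $R$ a semiring$^\dagger$, $\mathcal T\subset R$ a cancellative multiplicative submonoid (tangible elements), $\mathcal G$ an ideal of $R$ (ghost elements) with a partial order, and $\nu:R\to\mathcal G$ an idempotent homomorphism with $\nu|_{\mathcal T}$ onto, such that $a+b=a$ if $\nu(a)>\nu(b)$ and $a+b=\nu(a)$ if $\nu(a)=\nu(b)$. It is a $\nu$-semifield$^\dagger$ if $\mathcal T$ is an abelian group. Write $a^\nu=\nu(a)$; $a\cong_\nu b$ means $a^\nu=b^\nu$; $a\ge_\nu b$ means $a^\nu\ge b^\nu$. Set $a^*=a^{-1}$, $(a^\nu)^*=(a^{-1})^\nu$ for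 $a\in\mathcal T$, $|a|=a+a^*$, $a\wedge b=(a^*+b^* )^*$; these are applied to functions pointwise. **Rational functions.** $\overline{F[\Lambda]}$ is the semiring$^\dagger$ of functions $F^{(n)}\to F$ defined by polynomials over $F$, and $\overline{\mathcal T[\Lambda]}$ its subset defined by polynomials with tangible coefficients. $\overline{F(\Lambda)}$ is the localization of $\overline{F[\Lambda]}$ at $\overline{\mathcal T[\Lambda]}$; its elements $h/g$ are regarded as functions $\mathbf a\mapsto h(\mathbf a)g(\mathbf a)^*$. **Kernels.** A $\nu$-kernel of $\overline{F(\Lambda)}$ is a subgroup $K$ (closed under products and $*$) such that $a,b\in K$ and $\alpha+\beta\cong_\nu 1$ imply $\alpha a+\beta b\in K$; $\langle f\rangle$ is the $\nu$-kernel generated by $f$. $1_{\mathrm{loc}}(f)=\{\mathbf a: f(\mathbf a)\cong_\nu1\}$ is the set of kernel roots of $f$. A ghost root of a polynomial $p$ is a (tangible) point $\mathbf a$ with $p(\mathbf a)\in\mathcal G$. **Corner internal.** $f\in\overline{F(\Lambda)}$ is corner internal if one can write $f=h/g$ with polynomials $g,h$, $g\in\overline{\mathcal T[\Lambda]}$, such that every ghost root of $g+h$ is a kernel root of $f$; such a way of writing $f$ is called canonical, and the presentation $f=h/g$ used in forming $\Phi_{CI}(f)$ for corner internal $f$ is a canonical one. A principal $\nu$-kernel is corner internal if it has a corner internal generator. **Tilde.** For a polynomial $p=\sum_{i=1}^k p_i$ written as a sum of monomials, $\widehat{p_i}=p_i\bigl(\sum_{j\ne i}p_j\bigr)^*$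 and $\tilde p=\bigwedge_{i=1}^k|\widehat{p_i}|$.
   Formalization: f = h/g (also in "corner internal") is read up to ν-equivalence at every point; F is assumed to be the disjoint union of tangibles and ghosts; the order on ghosts is x ≤ y iff x+y = y; for a single monomial p the tilde factor is omitted. *)

theory Defs
  imports Main
begin

text \<open>
  A semiring without zero is the sort \<open>{comm_semiring, comm_monoid_mult}\<close>: neither class
  provides a \<open>0\<close>. The existence of \<open>r\<^sub>0 + r\<^sub>1 = 1\<close> is part of the locale below.
  The whole type is the carrier, \<open>T\<close> the tangible elements, \<open>G\<close> the ghost ideal and
  \<open>r\<close> the partial order of \<open>G\<close>, with \<open>(x, y) \<in> r\<close> meaning \<open>x \<le> y\<close>.
  Throughout, \<open>a\<close> and \<open>b\<close> are \<open>\<nu>\<close>-equivalent iff \<open>\<nu> a = \<nu> b\<close>.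
\<close>

locale nu_domain =
  fixes T :: "'a::{comm_semiring,comm_monoid_mult} set"
    and \<nu> :: "'a \<Rightarrow> 'a"
    and G :: "'a set"
    and r :: "('a \<times> 'a) set"
  assumes sum_one: "\<exists>r0 r1 :: 'a. r0 + r1 = 1"
    and one_T: "1 \<in> T"
    and mult_T: "a \<in> T \<Longrightarrow> b \<in> T \<Longrightarrow> a * b \<in> T"
    and cancel_T: "a \<in> T \<Longrightarrow> b \<in> T \<Longrightarrow> c \<in> T \<Longrightarrow> a * b = a * c \<Longrightarrow> b = c"
    and add_G: "x \<in> G \<Longrightarrow> y \<in> G \<Longrightarrow> x + y \<in> G"
    and mult_G: "x \<in> G \<Longrightarrow> a * x \<in> G"
    and order_G: "partial_order_on G r"
    and nu_in_G: "\<nu> a \<in> G"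
    and nu_idem: "\<nu> (\<nu> a) = \<nu> a"
    and nu_add: "\<nu> (a + b) = \<nu> a + \<nu> b"
    and nu_mult: "\<nu> (a * b) = \<nu> a * \<nu> b"
    and nu_onto: "\<nu> ` T = G"
    and add_greater: "(\<nu> b, \<nu> a) \<in> r \<Longrightarrow> \<nu> b \<noteq> \<nu> a \<Longrightarrow> a + b = a"
    and add_equiv: "\<nu> a = \<nu> b \<Longrightarrow> a + b = \<nu> a"

locale nu_semifield = nu_domain +
  assumes inverse_T: "a \<in> T \<Longrightarrow> \<exists>b\<in>T. a * b = 1"

definition tinv :: "'a::comm_monoid_mult set \<Rightarrow> 'a \<Rightarrow> 'a" where
  "tinv T a = (THE b. b \<in> T \<and> a * b = 1)"

text \<open>
  \<open>a\<^sup>* = a\<^sup>-\<^sup>1\<close> and \<open>(\<nu> a)\<^sup>* = \<nu> (a\<^sup>-\<^sup>1)\<close> for tangible \<open>a\<close>; the value on ghosts does not depend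
  on the tangible lift, see \<open>star_ghost\<close> below.
\<close>

definition star :: "'a::comm_monoid_mult set \<Rightarrow> ('a \<Rightarrow> 'a) \<Rightarrow> 'a \<Rightarrow> 'a" where
  "star T \<nu> a = (if a \<in> T then tinv T a else \<nu> (tinv T (SOME t. t \<in> T \<and> \<nu> t = a)))"

definition nabs :: "'a::{comm_semiring,comm_monoid_mult} set \<Rightarrow> ('a \<Rightarrow> 'a) \<Rightarrow> 'a \<Rightarrow> 'a" where
  "nabs T \<nu> a = a + star T \<nu> a"

definition wedge :: "'a::{comm_semiring,comm_monoid_mult} set \<Rightarrow> ('a \<Rightarrow> 'a) \<Rightarrow> 'a \<Rightarrow> 'a \<Rightarrow> 'a" where
  "wedge T \<nu> a b = star T \<nu> (star T \<nu> a + star T \<nu> b)"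

context nu_semifield
begin

lemma tinv:
  assumes "a \<in> T" shows "tinv T a \<in> T" and "a * tinv T a = 1"
proof -
  have "\<exists>!b. b \<in> T \<and> a * b = 1"
    using inverse_T[OF assms] cancel_T[OF assms] by metis
  from theI'[OF this] show "tinv T a \<in> T" "a * tinv T a = 1"
    by (simp_all add: tinv_def)
qed

lemma nu_tinv_cong:
  assumes "s \<in> T" "t \<in> T" "\<nu> s = \<nu> t"
  shows "\<nu> (tinv T s) = \<nu> (tinv T t)"
proof -
  have s: "s * tinv T s = 1" and t: "t * tinv T t = 1"
    using assms tinv(2) by blast+
  have "\<nu> (tinv T s) = \<nu> (tinv T s * (t * tinv T t))" by (simp add: t)
  also have "\<dots> = \<nu> (tinv T s * (s * tinv T t))" by (simp only: nu_mult assms(3))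
  also have "tinv T s * (s * tinv T t) = (s * tinv T s) * tinv T t" by (simp only: ac_simps)
  finally show ?thesis by (simp add: s)
qed

lemma star_tangible: "a \<in> T \<Longrightarrow> star T \<nu> a = tinv T a"
  by (simp add: star_def)

lemma star_ghost:
  assumes "t \<in> T" "\<nu> t \<notin> T"
  shows "star T \<nu> (\<nu> t) = \<nu> (tinv T t)"
proof -
  define s where "s = (SOME s. s \<in> T \<and> \<nu> s = \<nu> t)"
  have "s \<in> T \<and> \<nu> s = \<nu> t"
    unfolding s_def by (rule someI[of _ t]) (use assms in blast)
  then have "\<nu> (tinv T s) = \<nu> (tinv T t)"
    using nu_tinv_cong assms(1) by blast
  with assms(2) show ?thesis
    unfolding star_def s_def by (simp only: if_False)
qed

end

text \<open>Sums and meets of nonempty families; there is no neutral element to start from.\<close>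

fun fold1 :: "('a \<Rightarrow> 'a \<Rightarrow> 'a) \<Rightarrow> 'a list \<Rightarrow> 'a" where
  "fold1 f [] = undefined"
| "fold1 f [x] = x"
| "fold1 f (x # y # xs) = f x (fold1 f (y # xs))"

text \<open>
  A polynomial in \<open>CARD('n)\<close> variables is the nonempty list of its monomials
  \<open>(coefficient, exponents)\<close>, no two with the same exponents.
\<close>

type_synonym ('a, 'n) mpoly = "('a \<times> ('n \<Rightarrow> nat)) list"

definition is_poly :: "('a, 'n) mpoly \<Rightarrow> bool" where
  "is_poly p \<longleftrightarrow> p \<noteq> [] \<and> distinct (map snd p)"

definition tangible_poly :: "'a set \<Rightarrow> ('a, 'n) mpoly \<Rightarrow> bool" where
  "tangible_poly T p \<longleftrightarrow> is_poly p \<and> fst ` set p \<subseteq> T"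

definition eval_monom ::
  "'a::comm_monoid_mult \<times> ('n::finite \<Rightarrow> nat) \<Rightarrow> ('n \<Rightarrow> 'a) \<Rightarrow> 'a" where
  "eval_monom m x = fst m * (\<Prod>j\<in>UNIV. x j ^ snd m j)"

definition eval_poly ::
  "('a::{comm_semiring,comm_monoid_mult}, 'n::finite) mpoly \<Rightarrow> ('n \<Rightarrow> 'a) \<Rightarrow> 'a" where
  "eval_poly p x = fold1 (+) (map (\<lambda>m. eval_monom m x) p)"

text \<open>
  \<open>f = h/g\<close>. An element of the localization determines a function only up to
  \<open>\<nu>\<close>-equivalence: \<open>(1 + \<lambda>)/(1 + \<lambda>) = 1/1\<close>, but at \<open>\<lambda> = 1\<close> the left-hand side evaluates to
  \<open>\<nu> 1\<close>. Hence equality with \<open>h/g\<close> is \<open>\<nu>\<close>-equivalence at every point. With this reading the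
  rational functions are closed under the pointwise operations, which is not the case for the
  set of all functions that are exactly of the form \<open>x \<mapsto> h(x) g(x)\<^sup>*\<close>.
\<close>

definition is_fraction ::
  "'a::{comm_semiring,comm_monoid_mult} set \<Rightarrow> ('a \<Rightarrow> 'a) \<Rightarrow> (('n::finite \<Rightarrow> 'a) \<Rightarrow> 'a) \<Rightarrow>
    ('a, 'n) mpoly \<Rightarrow> ('a, 'n) mpoly \<Rightarrow> bool" where
  "is_fraction T \<nu> f h g \<longleftrightarrow> is_poly h \<and> tangible_poly T g \<and>
     (\<forall>x. \<nu> (f x) = \<nu> (eval_poly h x * star T \<nu> (eval_poly g x)))"

definition rat_funs ::
  "'a::{comm_semiring,comm_monoid_mult} set \<Rightarrow> ('a \<Rightarrow> 'a) \<Rightarrow> (('n::finite \<Rightarrow> 'a) \<Rightarrow> 'a) set" where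
  "rat_funs T \<nu> = {f. \<exists>h g. is_fraction T \<nu> f h g}"

definition nu_kernel ::
  "'a::{comm_semiring,comm_monoid_mult} set \<Rightarrow> ('a \<Rightarrow> 'a) \<Rightarrow>
    (('n::finite \<Rightarrow> 'a) \<Rightarrow> 'a) set \<Rightarrow> bool" where
  "nu_kernel T \<nu> K \<longleftrightarrow>
     K \<subseteq> rat_funs T \<nu> \<and>
     (\<lambda>x. 1) \<in> K \<and>
     (\<forall>a\<in>K. \<forall>b\<in>K. (\<lambda>x. a x * b x) \<in> K) \<and>
     (\<forall>a\<in>K. (\<lambda>x. star T \<nu> (a x)) \<in> K) \<and>
     (\<forall>a\<in>K. \<forall>b\<in>K. \<forall>\<alpha>\<in>rat_funs T \<nu>. \<forall>\<beta>\<in>rat_funs T \<nu>.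
        (\<forall>x. \<nu> (\<alpha> x + \<beta> x) = \<nu> 1) \<longrightarrow> (\<lambda>x. \<alpha> x * a x + \<beta> x * b x) \<in> K)"

definition generated_kernel ::
  "'a::{comm_semiring,comm_monoid_mult} set \<Rightarrow> ('a \<Rightarrow> 'a) \<Rightarrow>
    (('n::finite \<Rightarrow> 'a) \<Rightarrow> 'a) \<Rightarrow> (('n \<Rightarrow> 'a) \<Rightarrow> 'a) set" where
  "generated_kernel T \<nu> f = \<Inter>{K. nu_kernel T \<nu> K \<and> f \<in> K}"

definition kernel_roots ::
  "('a::comm_monoid_mult \<Rightarrow> 'a) \<Rightarrow> (('n \<Rightarrow> 'a) \<Rightarrow> 'a) \<Rightarrow> ('n \<Rightarrow> 'a) set" where
  "kernel_roots \<nu> f = {x. \<nu> (f x) = \<nu> 1}"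

definition ghost_roots ::
  "'a set \<Rightarrow> 'a set \<Rightarrow> (('n \<Rightarrow> 'a) \<Rightarrow> 'a) \<Rightarrow> ('n \<Rightarrow> 'a) set" where
  "ghost_roots T G p = {x. (\<forall>j. x j \<in> T) \<and> p x \<in> G}"

definition canonical ::
  "'a::{comm_semiring,comm_monoid_mult} set \<Rightarrow> ('a \<Rightarrow> 'a) \<Rightarrow> 'a set \<Rightarrow>
    (('n::finite \<Rightarrow> 'a) \<Rightarrow> 'a) \<Rightarrow> ('a, 'n) mpoly \<Rightarrow> ('a, 'n) mpoly \<Rightarrow> bool" where
  "canonical T \<nu> G f h g \<longleftrightarrow> is_fraction T \<nu> f h g \<and>
     ghost_roots T G (\<lambda>x. eval_poly g x + eval_poly h x) \<subseteq> kernel_roots \<nu> f"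

definition corner_internal ::
  "'a::{comm_semiring,comm_monoid_mult} set \<Rightarrow> ('a \<Rightarrow> 'a) \<Rightarrow> 'a set \<Rightarrow>
    (('n::finite \<Rightarrow> 'a) \<Rightarrow> 'a) \<Rightarrow> bool" where
  "corner_internal T \<nu> G f \<longleftrightarrow> (\<exists>h g. canonical T \<nu> G f h g)"

definition corner_internal_kernel ::
  "'a::{comm_semiring,comm_monoid_mult} set \<Rightarrow> ('a \<Rightarrow> 'a) \<Rightarrow> 'a set \<Rightarrow>
    (('n::finite \<Rightarrow> 'a) \<Rightarrow> 'a) set \<Rightarrow> bool" where
  "corner_internal_kernel T \<nu> G K \<longleftrightarrow>
     (\<exists>f\<in>rat_funs T \<nu>. corner_internal T \<nu> G f \<and> K = generated_kernel T \<nu> f)"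

text \<open>The function \<open>p_hat\<close> is used for polynomials with at least two monomials only.\<close>

definition p_hat ::
  "'a::{comm_semiring,comm_monoid_mult} set \<Rightarrow> ('a \<Rightarrow> 'a) \<Rightarrow>
    ('a, 'n::finite) mpoly \<Rightarrow> nat \<Rightarrow> ('n \<Rightarrow> 'a) \<Rightarrow> 'a" where
  "p_hat T \<nu> p i x =
     eval_monom (p ! i) x * star T \<nu> (eval_poly (take i p @ drop (Suc i) p) x)"

definition p_tilde ::
  "'a::{comm_semiring,comm_monoid_mult} set \<Rightarrow> ('a \<Rightarrow> 'a) \<Rightarrow>
    ('a, 'n::finite) mpoly \<Rightarrow> ('n \<Rightarrow> 'a) \<Rightarrow> 'a" where
  "p_tilde T \<nu> p x = fold1 (wedge T \<nu>) (map (\<lambda>i. nabs T \<nu> (p_hat T \<nu> p i x)) [0..<length p])"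

text \<open>
  For a single monomial \<open>p\<close> the sum over \<open>j \<noteq> i\<close> in \<open>p_hat\<close> is empty. Read as a formal zero, its
  \<open>*\<close> is infinite, and so is \<open>p_tilde\<close>; the factor \<open>u + \<infinity> = \<infinity>\<close> is then neutral for the meet.
  The list below omits it.
\<close>

definition tilde_factor ::
  "'a::{comm_semiring,comm_monoid_mult} set \<Rightarrow> ('a \<Rightarrow> 'a) \<Rightarrow> 'a \<Rightarrow>
    ('a, 'n::finite) mpoly \<Rightarrow> ('n \<Rightarrow> 'a) \<Rightarrow> 'a list" where
  "tilde_factor T \<nu> u p x = (if length p = 1 then [] else [u + p_tilde T \<nu> p x])"

definition Phi_CI ::
  "'a::{comm_semiring,comm_monoid_mult} set \<Rightarrow> ('a \<Rightarrow> 'a) \<Rightarrow> (('n::finite \<Rightarrow> 'a) \<Rightarrow> 'a) \<Rightarrow>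
    ('a, 'n) mpoly \<Rightarrow> ('a, 'n) mpoly \<Rightarrow> ('n \<Rightarrow> 'a) \<Rightarrow> 'a" where
  "Phi_CI T \<nu> f h g x = fold1 (wedge T \<nu>)
     ([nabs T \<nu> (f x)]
      @ tilde_factor T \<nu> (nabs T \<nu> (star T \<nu> (f x) + 1)) h x
      @ tilde_factor T \<nu> (nabs T \<nu> (f x + 1)) g x)"

end

theory Submission
  imports Defs
begin

text \<open>
  The order on \<open>G\<close> is total, since incomparable elements contradict associativity. Let
  \<open>p\<^sub>1, \<dots>, p\<^sub>N\<close> be the monomials of \<open>h\<close> and \<open>g\<close> together. Up to \<open>\<nu>\<close>-equivalence, \<open>Phi_CI\<close> at a point
  is the quotient of the largest \<open>p\<^sub>i\<close> by the second largest, so its kernel roots are the points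
  where the maximum is attained twice. A sum of tangible elements is ghost exactly when its
  maximum is attained twice; hence, once the coefficients of \<open>h\<close> are lifted to tangible ones, the
  ghost roots of \<open>g + h\<close> are the tangible kernel roots of \<open>Phi_CI\<close>. Moreover
  \<open>Phi_CI = (\<Sum>\<^sub>i p\<^sub>i\<^sup>2) / (\<Sum>\<^sub>i\<^sub>\<noteq>\<^sub>j p\<^sub>i p\<^sub>j)\<close>, and the numerator is ghost only where the maximum is
  attained twice, so this presentation is canonical.
\<close>

section \<open>The total preorder induced by \<open>\<nu>\<close>\<close>

locale nu_semifield_natural = nu_semifield T \<nu> G r
  for T :: "'a::{comm_semiring,comm_monoid_mult} set" and \<nu> G r +
  assumes tangible_or_ghost: "T \<union> G = UNIV" "T \<inter> G = {}"
    and natural_order: "\<And>x y. x \<in> G \<Longrightarrow> y \<in> G \<Longrightarrow> (x, y) \<in> r \<longleftrightarrow> x + y = y"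
begin

text \<open>The order of \<open>G\<close> pulled back along \<open>\<nu>\<close> to all elements. By
  \<open>natural_order\<close> it can be expressed through addition, so \<open>r\<close> is left
  behind once \<open>absorb\<close> is available.\<close>

definition nu_le :: "'a \<Rightarrow> 'a \<Rightarrow> bool" (infix "\<preceq>" 50) where
  "a \<preceq> b \<longleftrightarrow> \<nu> a + \<nu> b = \<nu> b"

lemma nu_le_refl [simp]: "a \<preceq> a"
  unfolding nu_le_def using add_equiv[of "\<nu> a" "\<nu> a"] nu_idem by simp

lemma nu_le_trans: "a \<preceq> b \<Longrightarrow> b \<preceq> c \<Longrightarrow> a \<preceq> c"
  unfolding nu_le_def by (metis add.assoc)

lemma nu_eq_iff: "\<nu> a = \<nu> b \<longleftrightarrow> a \<preceq> b \<and> b \<preceq> a"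
  by (metis add.commute nu_le_def nu_le_refl)

lemma nu_le_cong: "\<nu> a = \<nu> a' \<Longrightarrow> \<nu> b = \<nu> b' \<Longrightarrow> a \<preceq> b \<longleftrightarrow> a' \<preceq> b'"
  by (simp add: nu_le_def)

lemma tangible_lift: "\<exists>t\<in>T. \<nu> t = \<nu> a"
  using nu_onto nu_in_G by (metis imageE)

lemma absorb:
  assumes "b \<preceq> a" "\<not> a \<preceq> b"
  shows "a + b = a"
  using assms add_greater natural_order nu_in_G nu_le_def nu_eq_iff by metis

text \<open>
  Incomparable tangible \<open>s\<close> and \<open>t\<close> contradict associativity: for tangible \<open>c\<close> over \<open>\<nu> s + \<nu> t\<close>,
  the sum \<open>s + (t + c) = c\<close> is tangible, while \<open>(s + t) + c = \<nu> c\<close> is ghost.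
\<close>

lemma nu_le_total: "a \<preceq> b \<or> b \<preceq> a"
proof (rule ccontr)
  assume incomp: "\<not> (a \<preceq> b \<or> b \<preceq> a)"
  obtain s where s: "s \<in> T" "\<nu> s = \<nu> a" using tangible_lift by blast
  obtain t where t: "t \<in> T" "\<nu> t = \<nu> b" using tangible_lift by blast
  obtain c where c: "c \<in> T" "\<nu> c = \<nu> (a + b)" using tangible_lift by blast
  have st: "\<not> s \<preceq> t" "\<not> t \<preceq> s" using incomp s t by (simp_all add: nu_le_def)
  have le: "s \<preceq> c" "t \<preceq> c"
    using s t c nu_le_refl unfolding nu_le_def nu_add
    by (metis add.assoc, metis add.assoc add.commute)
  have nu_c: "\<nu> c = \<nu> s + \<nu> t" using s t c by (simp add: nu_add)
  have "\<not> c \<preceq> s" "\<not> c \<preceq> t"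
    using st le nu_le_trans by blast+
  then have "c + s = c" "c + t = c" using le absorb by blast+
  then have "s + t + c = c" by (metis add.commute add.assoc)
  moreover have "s + t + c = \<nu> (s + t)"
    using nu_c by (intro add_equiv) (simp add: nu_add)
  ultimately show False using c nu_in_G tangible_or_ghost by fastforce
qed

section \<open>Inverses up to \<open>\<nu>\<close>-equivalence\<close>

text \<open>For a ghost the inverse comes from a tangible lift. The rules for cancelling factors and
  clearing fractions rest on this identity: up to equivalence, the elements form a totally ordered
  abelian group.\<close>

lemma nu_star: "\<nu> a * \<nu> (star T \<nu> a) = \<nu> 1"
proof (cases "a \<in> T")
  case True
  then show ?thesis by (metis nu_mult star_tangible tinv(2))
next
  case False
  then have "a \<in> G" using tangible_or_ghost by blast
  then obtain t where t: "t \<in> T" "\<nu> t = a" using nu_onto by blast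
  then have "star T \<nu> a = \<nu> (tinv T t)" using star_ghost False by metis
  then show ?thesis using t nu_idem nu_mult tinv(2) by metis
qed

lemma nu_mult_one: "\<nu> a * \<nu> 1 = \<nu> a"
  by (simp flip: nu_mult)

lemma nu_le_mult_right: "a * c \<preceq> b * c \<longleftrightarrow> a \<preceq> b"
proof
  assume "a * c \<preceq> b * c"
  then have "(\<nu> a * \<nu> c + \<nu> b * \<nu> c) * \<nu> (star T \<nu> c) = \<nu> b * \<nu> c * \<nu> (star T \<nu> c)"
    by (simp add: nu_le_def nu_mult)
  then show "a \<preceq> b"
    by (simp only: distrib_right mult.assoc nu_star nu_mult_one nu_le_def)
next
  assume "a \<preceq> b"
  then show "a * c \<preceq> b * c" unfolding nu_le_def nu_mult by (metis distrib_right)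
qed

lemma nu_le_mult_left: "c * a \<preceq> c * b \<longleftrightarrow> a \<preceq> b"
  using nu_le_mult_right[of a c b] by (simp only: mult.commute)

lemma nu_le_mult_mono: "a \<preceq> b \<Longrightarrow> c \<preceq> d \<Longrightarrow> a * c \<preceq> b * d"
  using nu_le_mult_left nu_le_mult_right nu_le_trans by blast

text \<open>Multiplying both sides by \<open>b\<close> clears the fraction. Together with
  \<open>mult_star_nu_le\<close> this reduces comparisons of quotients to comparisons of
  products.\<close>

lemma nu_le_mult_star: "c \<preceq> a * star T \<nu> b \<longleftrightarrow> c * b \<preceq> a"
proof -
  have "c * b \<preceq> a * star T \<nu> b * b \<longleftrightarrow> c * b \<preceq> a"
    by (intro nu_le_cong refl)
      (simp only: nu_mult mult.assoc mult.commute[of "\<nu> (star T \<nu> b)"] nu_star,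
       simp flip: nu_mult)
  then show ?thesis using nu_le_mult_right by blast
qed

lemma nu_star_star: "\<nu> (star T \<nu> (star T \<nu> a)) = \<nu> a"
proof -
  have "\<nu> (star T \<nu> (star T \<nu> a)) = \<nu> (star T \<nu> (star T \<nu> a)) * (\<nu> a * \<nu> (star T \<nu> a))"
    unfolding nu_star by (simp flip: nu_mult)
  also have "\<dots> = \<nu> a * (\<nu> (star T \<nu> a) * \<nu> (star T \<nu> (star T \<nu> a)))" by (simp only: ac_simps)
  also have "\<dots> = \<nu> a" unfolding nu_star by (simp flip: nu_mult)
  finally show ?thesis .
qed

lemma nu_le_star: "c \<preceq> star T \<nu> b \<longleftrightarrow> c * b \<preceq> 1"
  using nu_le_mult_star[of c 1 b] by simp

lemma star_nu_le: "star T \<nu> b \<preceq> c \<longleftrightarrow> 1 \<preceq> c * b"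
proof -
  have "1 \<preceq> c * b \<longleftrightarrow> 1 \<preceq> c * star T \<nu> (star T \<nu> b)"
    by (intro nu_le_cong refl) (simp add: nu_mult nu_star_star)
  then show ?thesis by (simp add: nu_le_mult_star)
qed

lemma star_antimono: "star T \<nu> a \<preceq> star T \<nu> b \<longleftrightarrow> b \<preceq> a"
proof -
  have "star T \<nu> a \<preceq> star T \<nu> b \<longleftrightarrow> star T \<nu> a * b \<preceq> 1" by (rule nu_le_star)
  also have "\<dots> \<longleftrightarrow> b \<preceq> star T \<nu> (star T \<nu> a)" by (simp add: nu_le_star mult.commute)
  also have "\<dots> \<longleftrightarrow> b \<preceq> a" by (intro nu_le_cong nu_star_star refl)
  finally show ?thesis .
qed

section \<open>Sums, meets and absolute values described by their bounds\<close>

lemma add_nu_le: "a + b \<preceq> c \<longleftrightarrow> a \<preceq> c \<and> b \<preceq> c"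
proof
  assume le: "a + b \<preceq> c"
  have "a \<preceq> a + b" "b \<preceq> a + b"
    using nu_le_refl unfolding nu_le_def nu_add by (metis add.assoc, metis add.assoc add.commute)
  then show "a \<preceq> c \<and> b \<preceq> c" using le nu_le_trans by blast
next
  assume "a \<preceq> c \<and> b \<preceq> c"
  then show "a + b \<preceq> c" unfolding nu_le_def nu_add by (metis add.assoc)
qed

text \<open>By totality a sum, being the supremum of its summands, is equivalent to one of
  them.\<close>

lemma nu_le_add: "c \<preceq> a + b \<longleftrightarrow> c \<preceq> a \<or> c \<preceq> b"
proof -
  have "a \<preceq> a + b" "b \<preceq> a + b" using add_nu_le nu_le_refl by blast+
  moreover have "a + b \<preceq> a \<or> a + b \<preceq> b" using add_nu_le nu_le_total nu_le_refl by blast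
  ultimately show ?thesis using nu_le_trans by blast
qed

text \<open>\<open>star\<close> reverses the order and is an involution up to equivalence, so it
  turns the supremum \<open>+\<close> into an infimum.\<close>

lemma nu_le_wedge: "c \<preceq> wedge T \<nu> a b \<longleftrightarrow> c \<preceq> a \<and> c \<preceq> b"
proof -
  have "c \<preceq> wedge T \<nu> a b \<longleftrightarrow> star T \<nu> (star T \<nu> c) \<preceq> wedge T \<nu> a b"
    by (intro nu_le_cong nu_star_star[symmetric] refl)
  then show ?thesis unfolding wedge_def by (simp add: star_antimono add_nu_le)
qed

lemma nu_le_nabs: "c \<preceq> nabs T \<nu> a \<longleftrightarrow> c \<preceq> a \<or> c \<preceq> star T \<nu> a"
  by (simp add: nabs_def nu_le_add)

text \<open>\<open>a + 1\<close> is at least \<open>1\<close>, so its inverse is at most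
  \<open>1\<close> and adds nothing to the absolute value.\<close>

lemma nu_le_nabs_add_one: "c \<preceq> nabs T \<nu> (a + 1) \<longleftrightarrow> c \<preceq> a \<or> c \<preceq> 1"
proof -
  have "star T \<nu> (a + 1) \<preceq> 1" by (simp add: star_nu_le nu_le_add)
  then show ?thesis using nu_le_nabs nu_le_add nu_le_trans by blast
qed

lemma one_nu_le_nabs: "1 \<preceq> nabs T \<nu> a"
  using nu_le_nabs nu_le_star nu_le_total by (metis mult_1)

text \<open>An element is determined up to equivalence by its lower bounds. For this reason
  \<open>Phi_CI\<close> is described below through the elements \<open>c\<close> that lie under
  it.\<close>

lemma nu_eqI: "(\<And>c. c \<preceq> a \<longleftrightarrow> c \<preceq> b) \<Longrightarrow> \<nu> a = \<nu> b"
  unfolding nu_eq_iff by (meson nu_le_refl)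

lemma fold1_sum_nu_le: "xs \<noteq> [] \<Longrightarrow> fold1 (+) xs \<preceq> c \<longleftrightarrow> (\<forall>v\<in>set xs. v \<preceq> c)"
  by (induction "(+) :: 'a \<Rightarrow> _" xs rule: fold1.induct) (auto simp: add_nu_le)

lemma nu_le_fold1_sum: "xs \<noteq> [] \<Longrightarrow> c \<preceq> fold1 (+) xs \<longleftrightarrow> (\<exists>v\<in>set xs. c \<preceq> v)"
  by (induction "(+) :: 'a \<Rightarrow> _" xs rule: fold1.induct) (auto simp: nu_le_add)

lemma nu_le_fold1_wedge: "xs \<noteq> [] \<Longrightarrow> c \<preceq> fold1 (wedge T \<nu>) xs \<longleftrightarrow> (\<forall>v\<in>set xs. c \<preceq> v)"
  by (induction "wedge T \<nu>" xs rule: fold1.induct) (auto simp: nu_le_wedge)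

lemma mult_fold1_sum_nu_le:
  "xs \<noteq> [] \<Longrightarrow> c * fold1 (+) xs \<preceq> d \<longleftrightarrow> (\<forall>v\<in>set xs. c * v \<preceq> d)"
  using fold1_sum_nu_le[of xs "d * star T \<nu> c"] by (simp add: nu_le_mult_star mult.commute)

end

section \<open>Nonempty sums and the removal of one entry\<close>

lemma fold1_sum_append:
  fixes xs ys :: "'a::comm_semiring list"
  shows "xs \<noteq> [] \<Longrightarrow> ys \<noteq> [] \<Longrightarrow> fold1 (+) (xs @ ys) = fold1 (+) xs + fold1 (+) ys"
proof (induction "(+) :: 'a \<Rightarrow> _" xs rule: fold1.induct)
  case (2 x)
  then show ?case by (cases ys) simp_all
qed (simp_all add: add.assoc)

text \<open>Has the form of the list in \<open>p_hat\<close>, so that the denominators there are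
  instances.\<close>

abbreviation remove_nth :: "nat \<Rightarrow> 'a list \<Rightarrow> 'a list" where
  "remove_nth i xs \<equiv> take i xs @ drop (Suc i) xs"

lemma set_remove_nth:
  assumes "i < length xs"
  shows "set (remove_nth i xs) = {xs ! j | j. j < length xs \<and> j \<noteq> i}"
proof (intro set_eqI iffI)
  fix v assume "v \<in> set (remove_nth i xs)"
  then show "v \<in> {xs ! j | j. j < length xs \<and> j \<noteq> i}"
    using assms by (auto simp: in_set_conv_nth intro: exI[of _ "Suc i + _"])
next
  fix v assume "v \<in> {xs ! j | j. j < length xs \<and> j \<noteq> i}"
  then obtain j where j: "j < length xs" "j \<noteq> i" "v = xs ! j" by blast
  then consider "j < i" | "Suc i \<le> j" by linarith
  then show "v \<in> set (remove_nth i xs)"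
  proof cases
    case 1
    then have "v \<in> set (take i xs)" using assms j by (auto simp: in_set_conv_nth)
    then show ?thesis by simp
  next
    case 2
    then have "v \<in> set (drop (Suc i) xs)"
      using j by (auto simp: in_set_conv_nth intro!: exI[of _ "j - Suc i"])
    then show ?thesis by simp
  qed
qed

lemma fold1_sum_remove_nth:
  fixes xs :: "'a::comm_semiring list"
  assumes "i < length xs" "remove_nth i xs \<noteq> []"
  shows "fold1 (+) xs = xs ! i + fold1 (+) (remove_nth i xs)"
proof -
  have xs: "xs = take i xs @ [xs ! i] @ drop (Suc i) xs"
    using assms(1) by (simp add: id_take_nth_drop)
  \<comment> \<open>An empty \<open>as\<close> or \<open>bs\<close> is treated separately, because
    \<open>fold1\<close> of the empty list is \<open>undefined\<close>.\<close>
  have *: "fold1 (+) (as @ [v] @ bs) = v + fold1 (+) (as @ bs)" if "as @ bs \<noteq> []" for v :: 'a and as bs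
  proof (cases "as = []")
    case True
    then show ?thesis using that fold1_sum_append[of "[v]" bs] by simp
  next
    case False
    then show ?thesis
      using fold1_sum_append[of as "[v] @ bs"] fold1_sum_append[of as "[v]"]
        fold1_sum_append[of "[v]" bs] fold1_sum_append[of as bs]
      by (cases "bs = []") (auto simp: ac_simps)
  qed
  show ?thesis using *[OF assms(2)] xs by metis
qed

section \<open>Ties for the maximum and ghost sums\<close>

context nu_semifield_natural
begin

lemma mult_star_nu_le: "a * star T \<nu> b \<preceq> c \<longleftrightarrow> a \<preceq> c * b"
proof -
  have "a * star T \<nu> b * b \<preceq> c * b \<longleftrightarrow> a \<preceq> c * b"
    by (intro nu_le_cong refl)
      (simp only: nu_mult mult.assoc mult.commute[of "\<nu> (star T \<nu> b)"] nu_star nu_mult_one)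
  then show ?thesis using nu_le_mult_right by blast
qed

lemma star_cong: "\<nu> a = \<nu> b \<Longrightarrow> \<nu> (star T \<nu> a) = \<nu> (star T \<nu> b)"
  by (simp add: nu_eq_iff star_antimono)

text \<open>The tie is between positions, not values: two monomials that agree at a point count as
  tied. By transitivity the entry at \<open>j\<close> is maximal too.\<close>

definition top_tie :: "'a list \<Rightarrow> bool" where
  "top_tie xs \<longleftrightarrow> (\<exists>i<length xs. \<exists>j<length xs.
     i \<noteq> j \<and> (\<forall>v\<in>set xs. v \<preceq> xs ! i) \<and> xs ! i \<preceq> xs ! j)"

text \<open>The sum bounds all entries and lies below one of them, which is therefore
  maximal.\<close>

lemma ex_top: "xs \<noteq> [] \<Longrightarrow> \<exists>i<length xs. \<forall>v\<in>set xs. v \<preceq> xs ! i"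
  using nu_le_fold1_sum[of xs "fold1 (+) xs"] fold1_sum_nu_le nu_le_refl
  by (metis in_set_conv_nth)

lemma remove_nth_nonempty: "i < length xs \<Longrightarrow> j < length xs \<Longrightarrow> i \<noteq> j \<Longrightarrow> remove_nth i xs \<noteq> []"
  by auto

text \<open>One maximal entry is equivalent to the sum of the others, which it bounds and which
  include the second maximal entry. By \<open>add_equiv\<close> the total is then a value of
  \<open>\<nu>\<close>.\<close>

lemma top_tie_ghost:
  assumes "top_tie xs" shows "fold1 (+) xs \<in> G"
proof -
  from assms obtain i j where ij: "i < length xs" "j < length xs" "i \<noteq> j"
    and top: "\<forall>v\<in>set xs. v \<preceq> xs ! i" and le: "xs ! i \<preceq> xs ! j"
    unfolding top_tie_def by blast
  have ne: "remove_nth i xs \<noteq> []" using ij remove_nth_nonempty by blast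
  have "fold1 (+) (remove_nth i xs) \<preceq> xs ! i"
    unfolding fold1_sum_nu_le[OF ne] set_remove_nth[OF ij(1)] using top by auto
  moreover have "xs ! i \<preceq> fold1 (+) (remove_nth i xs)"
    unfolding nu_le_fold1_sum[OF ne] set_remove_nth[OF ij(1)] using ij le by auto
  ultimately have "fold1 (+) xs = \<nu> (xs ! i)"
    unfolding fold1_sum_remove_nth[OF ij(1) ne] by (simp add: add_equiv nu_eq_iff)
  then show ?thesis by (simp add: nu_in_G)
qed

text \<open>Without a tie, the unique maximal entry absorbs the sum of the others, so the total is
  that entry, which is tangible.\<close>

lemma ghost_sum_top_tie:
  assumes "xs \<noteq> []" "set xs \<subseteq> T" "fold1 (+) xs \<in> G"
  shows "top_tie xs"
proof (rule ccontr)
  assume no_tie: "\<not> top_tie xs"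
  obtain i where i: "i < length xs" "\<forall>v\<in>set xs. v \<preceq> xs ! i" using ex_top assms by blast
  have "fold1 (+) xs = xs ! i"
  proof (cases "remove_nth i xs = []")
    case True
    then obtain v where "xs = [v]" using i by (cases xs) auto
    then show ?thesis using i by simp
  next
    case ne: False
    have "fold1 (+) (remove_nth i xs) \<preceq> xs ! i"
      unfolding fold1_sum_nu_le[OF ne] set_remove_nth[OF i(1)] using i by auto
    moreover have "\<not> xs ! i \<preceq> fold1 (+) (remove_nth i xs)"
      unfolding nu_le_fold1_sum[OF ne] set_remove_nth[OF i(1)]
      using no_tie i unfolding top_tie_def by blast
    ultimately show ?thesis
      unfolding fold1_sum_remove_nth[OF i(1) ne] by (rule absorb)
  qed
  then have "fold1 (+) xs \<in> T" using assms(2) i(1) by auto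
  then show False using assms(3) tangible_or_ghost by blast
qed

text \<open>Transfers ties between a point or a list of coefficients and its tangible lift.\<close>

lemma top_tie_cong:
  assumes "map \<nu> xs = map \<nu> ys" "top_tie xs"
  shows "top_tie ys"
proof -
  have len: "length xs = length ys" using assms(1) by (metis length_map)
  have nth: "\<nu> (xs ! k) = \<nu> (ys ! k)" if "k < length xs" for k
    using assms(1) that len by (metis nth_map)
  have "xs ! k \<preceq> xs ! l \<longleftrightarrow> ys ! k \<preceq> ys ! l" if "k < length xs" "l < length xs" for k l
    using that nth by (intro nu_le_cong) auto
  then show ?thesis using assms(2) unfolding top_tie_def all_set_conv_all_nth len by metis
qed

section \<open>\<open>Phi_CI\<close> as the quotient of the two largest monomials\<close>

text \<open>The factor of index \<open>i\<close> is the largest monomial divided by the second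
  largest. A factor of index \<open>k\<close> other than \<open>i\<close> is the largest monomial
  divided by the one at \<open>k\<close>, which is no smaller. So the meet is the factor of index
  \<open>i\<close>.\<close>

lemma nu_le_p_tilde:
  fixes p :: "('a, 'n::finite) mpoly"
  defines "V \<equiv> \<lambda>x k. eval_monom (p ! k) x"
  assumes i: "i < length p" "length p \<noteq> 1" and top: "\<And>j. j < length p \<Longrightarrow> V x j \<preceq> V x i"
  shows "c \<preceq> p_tilde T \<nu> p x \<longleftrightarrow> (\<forall>j<length p. j \<noteq> i \<longrightarrow> c * V x j \<preceq> V x i)"
proof -
  define R where "R k = eval_poly (remove_nth k p) x" for k
  have ne: "remove_nth k p \<noteq> []" if "k < length p" for k
    using i that by (metis remove_nth_nonempty length_0_conv less_one linorder_neqE_nat not_less_zero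
        One_nat_def)
  have set: "set (map (\<lambda>m. eval_monom m x) (remove_nth k p)) = {V x j | j. j < length p \<and> j \<noteq> k}"
    if "k < length p" for k
    unfolding set_map set_remove_nth[OF that] V_def by auto
  have le_R: "d \<preceq> R k \<longleftrightarrow> (\<exists>j<length p. j \<noteq> k \<and> d \<preceq> V x j)" if "k < length p" for d k
    unfolding R_def eval_poly_def
    using nu_le_fold1_sum[of "map (\<lambda>m. eval_monom m x) (remove_nth k p)" d] set[OF that] ne[OF that]
    by auto
  have R_le: "d * R k \<preceq> e \<longleftrightarrow> (\<forall>j<length p. j \<noteq> k \<longrightarrow> d * V x j \<preceq> e)" if "k < length p" for d e k
    unfolding R_def eval_poly_def
    using mult_fold1_sum_nu_le[of "map (\<lambda>m. eval_monom m x) (remove_nth k p)" d e] set[OF that]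
      ne[OF that]
    by auto
  have tilde: "c \<preceq> p_tilde T \<nu> p x \<longleftrightarrow>
      (\<forall>k<length p. c * R k \<preceq> V x k \<or> c * V x k \<preceq> R k)"
  proof -
    have "c \<preceq> p_tilde T \<nu> p x \<longleftrightarrow> (\<forall>k<length p. c \<preceq> nabs T \<nu> (p_hat T \<nu> p k x))"
      unfolding p_tilde_def using i by (subst nu_le_fold1_wedge) auto
    also have "\<dots> \<longleftrightarrow> (\<forall>k<length p. c * R k \<preceq> V x k \<or> c * V x k \<preceq> R k)"
      unfolding nu_le_nabs p_hat_def nu_le_star nu_le_mult_star mult.assoc[symmetric] mult_star_nu_le
        R_def V_def by simp
    finally show ?thesis .
  qed
  show ?thesis
  proof
    assume "c \<preceq> p_tilde T \<nu> p x"
    then consider "c * R i \<preceq> V x i" | "c * V x i \<preceq> R i" using tilde i by blast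
    then show "\<forall>j<length p. j \<noteq> i \<longrightarrow> c * V x j \<preceq> V x i"
    proof cases
      case 1
      then show ?thesis using R_le i by blast
    next
      case 2
      \<comment> \<open>\<open>R i\<close> is at most the maximum, so this alternative forces
        \<open>c\<close> to be at most \<open>1\<close>.\<close>
      then have "c * V x i \<preceq> V x i" using le_R i top nu_le_trans by blast
      then have "c \<preceq> 1" using nu_le_mult_right[of c "V x i" 1] by simp
      then have "c * V x j \<preceq> V x j" for j using nu_le_mult_right[of c "V x j" 1] by simp
      then show ?thesis using top nu_le_trans by blast
    qed
  next
    assume le: "\<forall>j<length p. j \<noteq> i \<longrightarrow> c * V x j \<preceq> V x i"
    show "c \<preceq> p_tilde T \<nu> p x"
      \<comment> \<open>At \<open>k = i\<close> the first alternative holds by \<open>R_le\<close>.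
        At any other \<open>k\<close> the second one holds, since \<open>V x i\<close> is a summand
        of \<open>R k\<close>.\<close>
      unfolding tilde using le R_le le_R i by (metis nu_le_refl)
  qed
qed

text \<open>Each factor of the meet gives one conjunct; the disjuncts on lengths stand for omitted
  tilde factors.\<close>

lemma nu_le_Phi_CI:
  "c \<preceq> Phi_CI T \<nu> f h g x \<longleftrightarrow>
     (c \<preceq> f x \<or> c \<preceq> star T \<nu> (f x)) \<and>
     (length h = 1 \<or> c \<preceq> star T \<nu> (f x) \<or> c \<preceq> 1 \<or> c \<preceq> p_tilde T \<nu> h x) \<and>
     (length g = 1 \<or> c \<preceq> f x \<or> c \<preceq> 1 \<or> c \<preceq> p_tilde T \<nu> g x)"
  unfolding Phi_CI_def
  by (subst nu_le_fold1_wedge)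
    (auto simp: tilde_factor_def nu_le_add nu_le_nabs_add_one nu_le_nabs[of c "f x"])

lemma eval_poly_nu_le:
  "p \<noteq> [] \<Longrightarrow> eval_poly p x \<preceq> c \<longleftrightarrow> (\<forall>m\<in>set p. eval_monom m x \<preceq> c)"
  by (simp add: eval_poly_def fold1_sum_nu_le)

lemma nu_le_eval_poly:
  "p \<noteq> [] \<Longrightarrow> c \<preceq> eval_poly p x \<longleftrightarrow> (\<exists>m\<in>set p. c \<preceq> eval_monom m x)"
  by (simp add: eval_poly_def nu_le_fold1_sum)

lemma mult_eval_poly_nu_le:
  "p \<noteq> [] \<Longrightarrow> c * eval_poly p x \<preceq> d \<longleftrightarrow> (\<forall>m\<in>set p. c * eval_monom m x \<preceq> d)"
  by (simp add: eval_poly_def mult_fold1_sum_nu_le)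

text \<open>
  The left-hand side is \<open>c \<preceq> Phi_CI\<close> for the larger of \<open>h\<close> and \<open>g\<close> as \<open>p\<close>, the smaller as \<open>q\<close>, and
  \<open>u\<close>, \<open>w\<close> the corresponding one of \<open>f\<close> and its inverse.
\<close>

lemma nu_le_dominant:
  fixes p q :: "('a, 'n::finite) mpoly"
  assumes p: "i < length p" and q: "q \<noteq> []"
    and top: "\<And>m. m \<in> set p \<Longrightarrow> eval_monom m x \<preceq> eval_monom (p ! i) x"
    and u: "\<nu> u = \<nu> (eval_poly p x * star T \<nu> (eval_poly q x))"
    and le: "w \<preceq> 1" "1 \<preceq> u"
  shows "(c \<preceq> u \<or> c \<preceq> w) \<and> (length p = 1 \<or> c \<preceq> w \<or> c \<preceq> 1 \<or> c \<preceq> p_tilde T \<nu> p x) \<and>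
     (length q = 1 \<or> c \<preceq> u \<or> c \<preceq> 1 \<or> Q) \<longleftrightarrow>
     (\<forall>j<length p. j \<noteq> i \<longrightarrow> c * eval_monom (p ! j) x \<preceq> eval_monom (p ! i) x) \<and>
     (\<forall>m\<in>set q. c * eval_monom m x \<preceq> eval_monom (p ! i) x)"
    (is "_ \<longleftrightarrow> ?P \<and> ?Q")
proof -
  have "p \<noteq> []" using p by auto
  then have p_eq: "\<nu> (eval_poly p x) = \<nu> (eval_monom (p ! i) x)"
    unfolding nu_eq_iff eval_poly_nu_le[OF \<open>p \<noteq> []\<close>] nu_le_eval_poly[OF \<open>p \<noteq> []\<close>]
    using top p nth_mem nu_le_refl by blast
  have "c \<preceq> u \<longleftrightarrow> c * eval_poly q x \<preceq> eval_poly p x"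
    unfolding nu_le_cong[OF refl u] by (rule nu_le_mult_star)
  also have "\<dots> \<longleftrightarrow> c * eval_poly q x \<preceq> eval_monom (p ! i) x"
    using p_eq by (intro nu_le_cong) auto
  finally have c_u: "c \<preceq> u \<longleftrightarrow> ?Q" using mult_eval_poly_nu_le[OF q] by blast
  have one: "?P" if "c \<preceq> 1"
  proof -
    have "c * eval_monom (p ! j) x \<preceq> eval_monom (p ! j) x" for j
      using that nu_le_mult_right[of c _ 1] by simp
    then show ?thesis using top nu_le_trans nth_mem by blast
  qed
  have tilde: "c \<preceq> p_tilde T \<nu> p x \<longleftrightarrow> ?P" if "length p \<noteq> 1"
    using nu_le_p_tilde[OF p that] top nth_mem by blast
  have "?P" if "length p = 1" using that p by auto
  moreover have "c \<preceq> 1" if "c \<preceq> w" using that le(1) by (rule nu_le_trans)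
  moreover have "c \<preceq> u" if "c \<preceq> 1" using that le(2) by (rule nu_le_trans)
  \<comment> \<open>Since \<open>c \<preceq> w\<close> implies \<open>c \<preceq> 1\<close>, which
    implies \<open>c \<preceq> u\<close>, the first conjunct amounts to
    \<open>c \<preceq> u\<close>, that is \<open>?Q\<close>, and it implies the third. The second
    conjunct amounts to \<open>?P\<close>.\<close>
  ultimately show ?thesis using c_u one tilde by argo
qed

text \<open>At every point the larger of \<open>h\<close> and \<open>g\<close> contains a largest
  monomial. Its tilde compares this monomial with the others of the same polynomial, and
  \<open>|f|\<close> compares it with those of the other polynomial.\<close>

lemma nu_le_Phi_CI_iff:
  fixes h g :: "('a, 'n::finite) mpoly"
  assumes hg: "h \<noteq> []" "g \<noteq> []"
    and f: "\<nu> (f x) = \<nu> (eval_poly h x * star T \<nu> (eval_poly g x))"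
  defines "V \<equiv> map (\<lambda>m. eval_monom m x) (h @ g)"
  shows "\<exists>i<length V. (\<forall>v\<in>set V. v \<preceq> V ! i) \<and>
    (\<forall>c. c \<preceq> Phi_CI T \<nu> f h g x \<longleftrightarrow> (\<forall>j<length V. j \<noteq> i \<longrightarrow> c * V ! j \<preceq> V ! i))"
proof -
  have split: "(\<forall>j<length V. P j (V ! j)) \<longleftrightarrow>
      (\<forall>j<length h. P j (eval_monom (h ! j) x)) \<and>
      (\<forall>j<length g. P (length h + j) (eval_monom (g ! j) x))" for P
  proof safe
    fix j assume "\<forall>j<length V. P j (V ! j)"
    then show "P j (eval_monom (h ! j) x)" if "j < length h"
      using that \<open>\<forall>j<length V. P j (V ! j)\<close>[rule_format, of j]
      by (simp add: V_def nth_append)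
    show "P (length h + j) (eval_monom (g ! j) x)" if "j < length g"
      using that \<open>\<forall>j<length V. P j (V ! j)\<close>[rule_format, of "length h + j"]
      by (simp add: V_def nth_append)
  next
    fix j assume *: "\<forall>j<length h. P j (eval_monom (h ! j) x)"
      "\<forall>j<length g. P (length h + j) (eval_monom (g ! j) x)" "j < length V"
    then show "P j (V ! j)"
      using *(2)[rule_format, of "j - length h"]
      by (cases "j < length h") (simp_all add: V_def nth_append)
  qed
  have le_f: "c \<preceq> f x \<longleftrightarrow> c * eval_poly g x \<preceq> eval_poly h x" for c
    unfolding nu_le_cong[OF refl f] by (rule nu_le_mult_star)
  have f_le: "f x \<preceq> c \<longleftrightarrow> eval_poly h x \<preceq> c * eval_poly g x" for c
    unfolding nu_le_cong[OF f refl] by (rule mult_star_nu_le)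
  consider "eval_poly g x \<preceq> eval_poly h x" | "eval_poly h x \<preceq> eval_poly g x"
    using nu_le_total by blast
  then show ?thesis
  proof cases
    case 1
    obtain i where i: "i < length h" "\<And>m. m \<in> set h \<Longrightarrow> eval_monom m x \<preceq> eval_monom (h ! i) x"
      using ex_top[of "map (\<lambda>m. eval_monom m x) h"] hg by auto
    have Vi: "V ! i = eval_monom (h ! i) x" using i by (simp add: V_def nth_append)
    have "eval_poly h x \<preceq> V ! i" using eval_poly_nu_le hg i Vi by metis
    then have "eval_poly g x \<preceq> V ! i" using 1 nu_le_trans by blast
    then have "\<forall>v\<in>set V. v \<preceq> V ! i" using eval_poly_nu_le hg i Vi by (auto simp: V_def)
    moreover have "c \<preceq> Phi_CI T \<nu> f h g x \<longleftrightarrow> (\<forall>j<length V. j \<noteq> i \<longrightarrow> c * V ! j \<preceq> V ! i)" for c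
    proof -
      have le: "star T \<nu> (f x) \<preceq> 1" "1 \<preceq> f x" using 1 by (simp_all add: star_nu_le le_f)
      have "c \<preceq> Phi_CI T \<nu> f h g x \<longleftrightarrow>
          (\<forall>j<length h. j \<noteq> i \<longrightarrow> c * eval_monom (h ! j) x \<preceq> V ! i) \<and>
          (\<forall>m\<in>set g. c * eval_monom m x \<preceq> V ! i)"
        unfolding nu_le_Phi_CI Vi by (rule nu_le_dominant[OF i(1) hg(2) i(2) f le])
      then show ?thesis
        using i(1) unfolding split[of "\<lambda>j v. j \<noteq> i \<longrightarrow> c * v \<preceq> V ! i"] all_set_conv_all_nth
        by simp
    qed
    ultimately show ?thesis using i by (intro exI[of _ i]) (simp add: V_def)
  next
    case 2
    obtain i where i: "i < length g" "\<And>m. m \<in> set g \<Longrightarrow> eval_monom m x \<preceq> eval_monom (g ! i) x"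
      using ex_top[of "map (\<lambda>m. eval_monom m x) g"] hg by auto
    have Vi: "V ! (length h + i) = eval_monom (g ! i) x" using i by (simp add: V_def nth_append)
    have "eval_poly g x \<preceq> V ! (length h + i)" using eval_poly_nu_le hg i Vi by metis
    then have "eval_poly h x \<preceq> V ! (length h + i)" using 2 nu_le_trans by blast
    then have top: "\<forall>v\<in>set V. v \<preceq> V ! (length h + i)"
      using eval_poly_nu_le hg i Vi by (auto simp: V_def)
    \<comment> \<open>The inverse of \<open>f\<close> is \<open>g/h\<close>, so
      \<open>nu_le_dominant\<close> applies with \<open>h\<close> and \<open>g\<close>
      exchanged.\<close>
    have star_f: "\<nu> (star T \<nu> (f x)) = \<nu> (eval_poly g x * star T \<nu> (eval_poly h x))"
    proof (rule nu_eqI)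
      fix c
      have "c \<preceq> star T \<nu> (f x) \<longleftrightarrow> c * (eval_poly h x * star T \<nu> (eval_poly g x)) \<preceq> 1"
        unfolding nu_le_star using f by (intro nu_le_cong) (simp_all add: nu_mult)
      then show "c \<preceq> star T \<nu> (f x) \<longleftrightarrow> c \<preceq> eval_poly g x * star T \<nu> (eval_poly h x)"
        by (simp add: nu_le_mult_star mult_star_nu_le mult.assoc[symmetric])
    qed
    have "c \<preceq> Phi_CI T \<nu> f h g x \<longleftrightarrow>
        (\<forall>j<length V. j \<noteq> length h + i \<longrightarrow> c * V ! j \<preceq> V ! (length h + i))" for c
    proof -
      have le: "f x \<preceq> 1" "1 \<preceq> star T \<nu> (f x)" using 2 by (simp_all add: nu_le_star f_le)
      have "c \<preceq> Phi_CI T \<nu> f h g x \<longleftrightarrow>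
          (c \<preceq> star T \<nu> (f x) \<or> c \<preceq> f x) \<and>
          (length g = 1 \<or> c \<preceq> f x \<or> c \<preceq> 1 \<or> c \<preceq> p_tilde T \<nu> g x) \<and>
          (length h = 1 \<or> c \<preceq> star T \<nu> (f x) \<or> c \<preceq> 1 \<or> c \<preceq> p_tilde T \<nu> h x)"
        unfolding nu_le_Phi_CI by blast
      also have "\<dots> \<longleftrightarrow>
          (\<forall>j<length g. j \<noteq> i \<longrightarrow> c * eval_monom (g ! j) x \<preceq> V ! (length h + i)) \<and>
          (\<forall>m\<in>set h. c * eval_monom m x \<preceq> V ! (length h + i))"
        unfolding Vi by (rule nu_le_dominant[OF i(1) hg(1) i(2) star_f le])
      finally show ?thesis
        using i(1)
        unfolding split[of "\<lambda>j v. j \<noteq> length h + i \<longrightarrow> c * v \<preceq> V ! (length h + i)"]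
          all_set_conv_all_nth
        by auto
    qed
    with top show ?thesis using i by (intro exI[of _ "length h + i"]) (simp add: V_def)
  qed
qed

section \<open>Polynomials under a change of point or coefficients\<close>

lemma prod_tangible: "finite A \<Longrightarrow> (\<And>j. j \<in> A \<Longrightarrow> x j \<in> T) \<Longrightarrow> (\<Prod>j\<in>A. x j) \<in> T"
  by (induction A rule: finite_induct) (auto intro: one_T mult_T)

lemma power_tangible: "a \<in> T \<Longrightarrow> a ^ k \<in> T"
  by (induction k) (auto intro: one_T mult_T)

lemma eval_monom_tangible: "fst m \<in> T \<Longrightarrow> (\<And>j. x j \<in> T) \<Longrightarrow> eval_monom m x \<in> T"
  unfolding eval_monom_def by (intro mult_T prod_tangible power_tangible) auto

lemma nu_power_cong: "\<nu> a = \<nu> b \<Longrightarrow> \<nu> (a ^ k) = \<nu> (b ^ k)"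
  by (induction k) (auto simp: nu_mult)

lemma nu_prod_cong:
  "finite A \<Longrightarrow> (\<And>j. j \<in> A \<Longrightarrow> \<nu> (x j) = \<nu> (y j)) \<Longrightarrow> \<nu> (\<Prod>j\<in>A. x j) = \<nu> (\<Prod>j\<in>A. y j)"
  by (induction A rule: finite_induct) (auto simp: nu_mult)

lemma eval_monom_cong:
  assumes "\<nu> (fst m) = \<nu> (fst m')" "snd m = snd m'" "\<And>j. \<nu> (x j) = \<nu> (y j)"
  shows "\<nu> (eval_monom m x) = \<nu> (eval_monom m' y)"
proof -
  have "\<nu> (\<Prod>j\<in>UNIV. x j ^ snd m j) = \<nu> (\<Prod>j\<in>UNIV. y j ^ snd m' j)"
    using assms by (intro nu_prod_cong) (auto intro: nu_power_cong)
  then show ?thesis by (simp add: eval_monom_def nu_mult assms(1))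
qed

lemma eval_monom_nu_le: "fst m \<preceq> fst m' \<Longrightarrow> snd m = snd m' \<Longrightarrow> eval_monom m x \<preceq> eval_monom m' x"
  by (simp add: eval_monom_def nu_le_mult_right)

lemma nu_fold1_sum: "xs \<noteq> [] \<Longrightarrow> \<nu> (fold1 (+) xs) = fold1 (+) (map \<nu> xs)"
  by (induction "(+) :: 'a \<Rightarrow> _" xs rule: fold1.induct) (simp_all add: nu_add)

lemma eval_poly_cong:
  assumes "p \<noteq> []"
    "map (\<lambda>m. \<nu> (eval_monom m x)) p = map (\<lambda>m. \<nu> (eval_monom m y)) q"
  shows "\<nu> (eval_poly p x) = \<nu> (eval_poly q y)"
proof -
  have "q \<noteq> []" using assms by auto
  with assms show ?thesis by (simp add: eval_poly_def nu_fold1_sum comp_def)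
qed

lemma eval_poly_append:
  "p \<noteq> [] \<Longrightarrow> q \<noteq> [] \<Longrightarrow> eval_poly (p @ q) x = eval_poly p x + eval_poly q x"
  by (simp add: eval_poly_def fold1_sum_append)

lemma tangible_poly_top_tie:
  assumes "p \<noteq> []" "fst ` set p \<subseteq> T" "\<And>j. x j \<in> T" "eval_poly p x \<in> G"
  shows "top_tie (map (\<lambda>m. eval_monom m x) p)"
  using assms by (intro ghost_sum_top_tie) (auto simp: eval_poly_def intro!: eval_monom_tangible)

text \<open>
  Of the monomials with the same exponents only one with the largest coefficient is kept, and
  that coefficient is replaced by a tangible lift.
\<close>

lemma ex_tangible_poly:
  fixes ms :: "('a, 'n::finite) mpoly"
  assumes "ms \<noteq> []"
  obtains q where "tangible_poly T q" "\<And>x. \<nu> (eval_poly q x) = \<nu> (eval_poly ms x)"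
    "\<And>x. (\<And>j. x j \<in> T) \<Longrightarrow> eval_poly q x \<in> G \<Longrightarrow> top_tie (map (\<lambda>m. eval_monom m x) ms)"
proof -
  have "\<exists>m\<in>set ms. snd m = e \<and> (\<forall>m'\<in>set ms. snd m' = e \<longrightarrow> fst m' \<preceq> fst m)"
    if "e \<in> snd ` set ms" for e
  proof -
    let ?L = "filter (\<lambda>m. snd m = e) ms"
    have "map fst ?L \<noteq> []" using that by (auto simp: filter_empty_conv)
    from ex_top[OF this] obtain i where i: "i < length ?L" "\<forall>v\<in>set (map fst ?L). v \<preceq> fst (?L ! i)"
      by auto
    then have "?L ! i \<in> set ?L" by (metis nth_mem)
    then show ?thesis using i(2) by (intro bexI[of _ "?L ! i"]) auto
  qed
  then obtain w where w: "\<And>e. e \<in> snd ` set ms \<Longrightarrow> w e \<in> set ms \<and> snd (w e) = e \<and>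
      (\<forall>m'\<in>set ms. snd m' = e \<longrightarrow> fst m' \<preceq> fst (w e))"
    by metis
  obtain t where t: "\<And>a. t a \<in> T \<and> \<nu> (t a) = \<nu> a" using tangible_lift by metis
  define q where "q = map (\<lambda>e. (t (fst (w e)), e)) (remdups (map snd ms))"
  have q_ne: "q \<noteq> []" using assms by (simp add: q_def)
  have val: "\<nu> (eval_monom m x) = \<nu> (eval_monom (w (snd m)) x)" "w (snd m) \<in> set ms"
    "snd m \<in> snd ` set ms" if "m \<in> set q" for m x
  proof -
    from that obtain e where e: "e \<in> snd ` set ms" "m = (t (fst (w e)), e)"
      by (auto simp: q_def)
    then show "\<nu> (eval_monom m x) = \<nu> (eval_monom (w (snd m)) x)"
      using w t by (intro eval_monom_cong) auto
    show "w (snd m) \<in> set ms" "snd m \<in> snd ` set ms" using e w by auto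
  qed
  have dom: "\<exists>m'\<in>set q. eval_monom m x \<preceq> eval_monom m' x" if "m \<in> set ms" for m x
  proof
    have e: "snd m \<in> snd ` set ms" using that by blast
    show mem: "(t (fst (w (snd m))), snd m) \<in> set q" using e by (auto simp: q_def)
    have "eval_monom m x \<preceq> eval_monom (w (snd m)) x"
      using w[OF e] that by (intro eval_monom_nu_le) auto
    then show "eval_monom m x \<preceq> eval_monom (t (fst (w (snd m))), snd m) x"
      using val(1)[OF mem] nu_le_cong by (metis snd_conv)
  qed
  have dom': "\<exists>m'\<in>set ms. eval_monom m x \<preceq> eval_monom m' x" if "m \<in> set q" for m x
  proof
    show "w (snd m) \<in> set ms" using val(2) that .
    show "eval_monom m x \<preceq> eval_monom (w (snd m)) x" using val(1)[OF that] nu_eq_iff by blast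
  qed
  have eq: "\<nu> (eval_poly q x) = \<nu> (eval_poly ms x)" for x
  proof -
    have "eval_poly q x \<preceq> eval_poly ms x"
      using dom' eval_poly_nu_le[OF q_ne] nu_le_eval_poly[OF assms] by blast
    moreover have "eval_poly ms x \<preceq> eval_poly q x"
      using dom eval_poly_nu_le[OF assms] nu_le_eval_poly[OF q_ne] by blast
    ultimately show ?thesis by (simp add: nu_eq_iff)
  qed
  have poly: "tangible_poly T q"
    using q_ne t by (auto simp: tangible_poly_def is_poly_def q_def comp_def)
  have tie: "top_tie (map (\<lambda>m. eval_monom m x) ms)"
    if x: "\<And>j. x j \<in> T" and ghost: "eval_poly q x \<in> G" for x
  proof -
    have "top_tie (map (\<lambda>m. eval_monom m x) q)"
      using poly x ghost q_ne by (intro tangible_poly_top_tie) (auto simp: tangible_poly_def)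
    then obtain i j where ij: "i < length q" "j < length q" "i \<noteq> j"
      and top: "\<forall>m\<in>set q. eval_monom m x \<preceq> eval_monom (q ! i) x"
      and le: "eval_monom (q ! i) x \<preceq> eval_monom (q ! j) x"
      unfolding top_tie_def by auto
    \<comment> \<open>Tied monomials of \<open>q\<close> have different exponents, so their
      representatives in \<open>ms\<close> are different and occupy different positions.\<close>
    have "distinct (map snd q)" using poly by (simp add: tangible_poly_def is_poly_def)
    then have "snd (q ! i) \<noteq> snd (q ! j)"
      using ij by (metis length_map nth_eq_iff_index_eq nth_map)
    moreover have mem: "q ! i \<in> set q" "q ! j \<in> set q" using ij by simp_all
    ultimately have "w (snd (q ! i)) \<noteq> w (snd (q ! j))" using w val(3) by metis
    then obtain k l where kl: "k < length ms" "l < length ms" "k \<noteq> l"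
      "ms ! k = w (snd (q ! i))" "ms ! l = w (snd (q ! j))"
      using val(2) mem by (metis in_set_conv_nth)
    have nu: "\<nu> (eval_monom (ms ! k) x) = \<nu> (eval_monom (q ! i) x)"
      "\<nu> (eval_monom (ms ! l) x) = \<nu> (eval_monom (q ! j) x)"
      using val(1) mem kl by metis+
    have "\<forall>m\<in>set ms. eval_monom m x \<preceq> eval_monom (ms ! k) x"
    proof
      fix m assume "m \<in> set ms"
      then obtain m' where "m' \<in> set q" "eval_monom m x \<preceq> eval_monom m' x" using dom by blast
      then have "eval_monom m x \<preceq> eval_monom (q ! i) x" using top nu_le_trans by blast
      then show "eval_monom m x \<preceq> eval_monom (ms ! k) x" using nu(1) nu_le_cong by metis
    qed
    moreover have "eval_monom (ms ! k) x \<preceq> eval_monom (ms ! l) x"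
      using le nu nu_le_cong by blast
    ultimately show ?thesis
      using kl unfolding top_tie_def by (intro exI[of _ k] exI[of _ l] conjI) auto
  qed
  show thesis using that poly eq tie by blast
qed

section \<open>Kernel roots of \<open>Phi_CI\<close>\<close>

lemma is_fraction_nonempty:
  assumes "is_fraction T \<nu> f h g" shows "h \<noteq> []" "g \<noteq> []"
  using assms by (auto simp: is_fraction_def tangible_poly_def is_poly_def)

lemma is_fraction_nu:
  "is_fraction T \<nu> f h g \<Longrightarrow> \<nu> (f x) = \<nu> (eval_poly h x * star T \<nu> (eval_poly g x))"
  by (simp add: is_fraction_def)

lemma mult_nu_le_of_le_one: "c \<preceq> 1 \<Longrightarrow> c * a \<preceq> a"
  using nu_le_mult_right[of c a 1] by simp

lemma one_nu_le_Phi_CI: "1 \<preceq> Phi_CI T \<nu> f h g x"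
  using one_nu_le_nabs[of "f x"] by (simp add: nu_le_Phi_CI nu_le_nabs)

text \<open>The quotient of the largest monomial by the second largest is equivalent to
  \<open>1\<close> exactly when these two are equivalent.\<close>

lemma Phi_CI_root_iff_top_tie:
  assumes fr: "is_fraction T \<nu> f h g"
  shows "\<nu> (Phi_CI T \<nu> f h g x) = \<nu> 1 \<longleftrightarrow> top_tie (map (\<lambda>m. eval_monom m x) (h @ g))"
proof -
  define V where "V = map (\<lambda>m. eval_monom m x) (h @ g)"
  obtain i where i: "i < length V" "\<forall>v\<in>set V. v \<preceq> V ! i"
    and Phi: "\<And>c. c \<preceq> Phi_CI T \<nu> f h g x \<longleftrightarrow> (\<forall>j<length V. j \<noteq> i \<longrightarrow> c * V ! j \<preceq> V ! i)"
    using nu_le_Phi_CI_iff[where f = f and x = x, OF is_fraction_nonempty[OF fr] is_fraction_nu[OF fr]]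
    unfolding V_def by blast
  \<comment> \<open>\<open>h\<close> and \<open>g\<close> contribute at least one monomial each, so
    a second largest entry exists.\<close>
  have len: "2 \<le> length V"
    using is_fraction_nonempty[OF fr] by (simp add: V_def Suc_le_eq neq_Nil_conv) auto
  then have ne: "remove_nth i V \<noteq> []" by auto
  define R where "R = fold1 (+) (remove_nth i V)"
  show ?thesis
    unfolding V_def[symmetric]
  proof
    assume root: "\<nu> (Phi_CI T \<nu> f h g x) = \<nu> 1"
    \<comment> \<open>The test value for \<open>c\<close> is the largest entry divided by
      \<open>R\<close>, which is equivalent to the second largest. It lies under
      \<open>Phi_CI\<close>, hence under \<open>1\<close>.\<close>
    have "V ! i * star T \<nu> R * V ! j \<preceq> V ! i" if "j < length V" "j \<noteq> i" for j
    proof -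
      have "V ! j \<preceq> R"
        unfolding R_def nu_le_fold1_sum[OF ne] set_remove_nth[OF i(1)] using that nu_le_refl by blast
      then have "V ! i * V ! j \<preceq> V ! i * R" by (simp add: nu_le_mult_left)
      then have "V ! i * V ! j * star T \<nu> R \<preceq> V ! i" by (simp only: mult_star_nu_le)
      then show ?thesis by (simp only: ac_simps)
    qed
    then have "V ! i * star T \<nu> R \<preceq> Phi_CI T \<nu> f h g x" using Phi by blast
    then have "V ! i * star T \<nu> R \<preceq> 1" using root nu_eq_iff nu_le_trans by blast
    then have "V ! i \<preceq> R" by (simp add: mult_star_nu_le)
    then show "top_tie V"
      unfolding R_def nu_le_fold1_sum[OF ne] set_remove_nth[OF i(1)] top_tie_def using i by blast
  next
    assume "top_tie V"
    \<comment> \<open>Of the two tied positions at least one differs from \<open>i\<close>.\<close>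
    then obtain j where j: "j < length V" "j \<noteq> i" "V ! i \<preceq> V ! j"
      unfolding top_tie_def using i nu_le_trans nth_mem by metis
    show "\<nu> (Phi_CI T \<nu> f h g x) = \<nu> 1"
    proof (rule nu_eqI)
      fix c
      have "c \<preceq> 1" if "c * V ! j \<preceq> V ! i"
        using nu_le_trans[OF that j(3)] nu_le_mult_right[of c "V ! j" 1] by simp
      moreover have "c * V ! k \<preceq> V ! i" if "c \<preceq> 1" "k < length V" for k
        using mult_nu_le_of_le_one[OF that(1)] i that nu_le_trans nth_mem by blast
      ultimately show "c \<preceq> Phi_CI T \<nu> f h g x \<longleftrightarrow> c \<preceq> 1"
        unfolding Phi using j by blast
    qed
  qed
qed

section \<open>A canonical presentation of \<open>Phi_CI\<close>\<close>

definition monom_mult :: "'a \<times> ('n::finite \<Rightarrow> nat) \<Rightarrow> 'a \<times> ('n \<Rightarrow> nat) \<Rightarrow> 'a \<times> ('n \<Rightarrow> nat)" where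
  "monom_mult m m' = (fst m * fst m', \<lambda>k. snd m k + snd m' k)"

lemma eval_monom_mult: "eval_monom (monom_mult m m') x = eval_monom m x * eval_monom m' x"
  by (simp add: eval_monom_def monom_mult_def power_add prod.distrib ac_simps)

text \<open>If \<open>a \<preceq> b\<close> fails, totality gives \<open>b \<preceq> a\<close>,
  hence \<open>a * a \<preceq> b * b \<preceq> b * a\<close>, and cancelling \<open>a\<close> is a
  contradiction.\<close>

lemma square_nu_le: "a * a \<preceq> b * b \<longleftrightarrow> a \<preceq> b"
proof
  assume le: "a * a \<preceq> b * b"
  show "a \<preceq> b"
  proof (rule ccontr)
    assume "\<not> a \<preceq> b"
    then have "b * b \<preceq> b * a" using nu_le_total nu_le_mult_left by blast
    with le have "a * a \<preceq> b * a" using nu_le_trans by blast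
    with \<open>\<not> a \<preceq> b\<close> show False by (simp add: nu_le_mult_right)
  qed
qed (simp add: nu_le_mult_mono)

lemma top_tie_square:
  assumes "top_tie (map (\<lambda>v. v * v) xs)" shows "top_tie xs"
proof -
  from assms obtain i j where "i < length xs" "j < length xs" "i \<noteq> j"
    "\<forall>v\<in>set xs. v * v \<preceq> xs ! i * xs ! i" "xs ! i * xs ! i \<preceq> xs ! j * xs ! j"
    unfolding top_tie_def by auto
  then show ?thesis unfolding top_tie_def square_nu_le by blast
qed

text \<open>The largest square is that of the largest monomial, and the largest product of two
  different positions pairs it with the second largest; one factor cancels in the quotient.\<close>

lemma corner_internal_Phi_CI:
  fixes h g :: "('a, 'n::finite) mpoly"
  assumes fr: "is_fraction T \<nu> f h g"
  shows "corner_internal T \<nu> G (Phi_CI T \<nu> f h g)"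
proof -
  define L where "L = h @ g"
  define sq where "sq = map (\<lambda>m. monom_mult m m) L"
  let ?P = "{monom_mult (L ! a) (L ! b) | a b. a < length L \<and> b < length L \<and> a \<noteq> b}"
  have "?P \<subseteq> (\<lambda>(m, m'). monom_mult m m') ` (set L \<times> set L)" by force
  then have "finite ?P" by (rule finite_subset) simp
  from finite_list[OF this] obtain pr where pr: "set pr = ?P" ..
  have L_ne: "L \<noteq> []" using is_fraction_nonempty[OF fr] by (simp add: L_def)
  have "1 < length L"
    using is_fraction_nonempty[OF fr] by (auto simp: L_def neq_Nil_conv)
  then have "monom_mult (L ! 0) (L ! 1) \<in> set pr"
    unfolding pr by (intro CollectI exI[of _ 0] exI[of _ 1]) auto
  then have pr_ne: "pr \<noteq> []" by auto
  have sq_ne: "sq \<noteq> []" using L_ne by (simp add: sq_def)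
  \<comment> \<open>Several entries of \<open>sq\<close> or \<open>pr\<close> may share their
    exponents, and \<open>h\<close> may have ghost coefficients, so both lists are replaced by
    equivalent tangible polynomials.\<close>
  obtain p where p: "tangible_poly T p" "\<And>x. \<nu> (eval_poly p x) = \<nu> (eval_poly sq x)"
    "\<And>x. (\<And>j. x j \<in> T) \<Longrightarrow> eval_poly p x \<in> G \<Longrightarrow> top_tie (map (\<lambda>m. eval_monom m x) sq)"
    using ex_tangible_poly[OF sq_ne] by blast
  obtain q where q: "tangible_poly T q" "\<And>x. \<nu> (eval_poly q x) = \<nu> (eval_poly pr x)"
    using ex_tangible_poly[OF pr_ne] by blast
  have nu_Phi: "\<nu> (Phi_CI T \<nu> f h g x) = \<nu> (eval_poly p x * star T \<nu> (eval_poly q x))" for x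
  proof (rule nu_eqI)
    fix c
    define V where "V = map (\<lambda>m. eval_monom m x) L"
    obtain i where i: "i < length V" "\<forall>v\<in>set V. v \<preceq> V ! i"
      and Phi: "c \<preceq> Phi_CI T \<nu> f h g x \<longleftrightarrow> (\<forall>j<length V. j \<noteq> i \<longrightarrow> c * V ! j \<preceq> V ! i)"
      using nu_le_Phi_CI_iff[where f = f and x = x, OF is_fraction_nonempty[OF fr] is_fraction_nu[OF fr]]
      unfolding V_def L_def by blast
    have "\<nu> (eval_poly p x) = \<nu> (V ! i * V ! i)"
      unfolding p(2) nu_eq_iff eval_poly_nu_le[OF sq_ne] nu_le_eval_poly[OF sq_ne]
      using i by (auto simp: sq_def eval_monom_mult square_nu_le V_def intro!: bexI[of _ "L ! i"])
    then have "c * eval_poly q x \<preceq> eval_poly p x \<longleftrightarrow> c * eval_poly pr x \<preceq> V ! i * V ! i"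
      by (intro nu_le_cong) (simp_all add: nu_mult q(2))
    also have "\<dots> \<longleftrightarrow> (\<forall>a<length L. \<forall>b<length L. a \<noteq> b \<longrightarrow>
        c * eval_monom (monom_mult (L ! a) (L ! b)) x \<preceq> V ! i * V ! i)"
      unfolding mult_eval_poly_nu_le[OF pr_ne] pr by blast
    also have "\<dots> \<longleftrightarrow> (\<forall>a<length V. \<forall>b<length V. a \<noteq> b \<longrightarrow> c * (V ! a * V ! b) \<preceq> V ! i * V ! i)"
      by (simp add: V_def eval_monom_mult)
    also have "\<dots> \<longleftrightarrow> (\<forall>j<length V. j \<noteq> i \<longrightarrow> c * V ! j \<preceq> V ! i)"
    proof (intro iffI allI impI)
      fix j assume "\<forall>a<length V. \<forall>b<length V. a \<noteq> b \<longrightarrow> c * (V ! a * V ! b) \<preceq> V ! i * V ! i"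
        "j < length V" "j \<noteq> i"
      then have "c * V ! j * V ! i \<preceq> V ! i * V ! i" using i(1) by (simp add: mult.assoc)
      then show "c * V ! j \<preceq> V ! i" by (simp add: nu_le_mult_right)
    next
      fix a b assume le: "\<forall>j<length V. j \<noteq> i \<longrightarrow> c * V ! j \<preceq> V ! i"
        and ab: "a < length V" "b < length V" "a \<noteq> b"
      \<comment> \<open>One of \<open>a\<close> and \<open>b\<close> differs from \<open>i\<close>;
        \<open>le\<close> bounds \<open>c\<close> times that entry, and maximality of
        \<open>V ! i\<close> bounds the other.\<close>
      have *: "c * (V ! k * V ! l) \<preceq> V ! i * V ! i" if "k < length V" "l < length V" "k \<noteq> i" for k l
        using that le i(2) nu_le_mult_mono[of "c * V ! k" "V ! i" "V ! l" "V ! i"]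
        by (simp add: mult.assoc)
      show "c * (V ! a * V ! b) \<preceq> V ! i * V ! i"
        using *[of a b] *[of b a] ab by (cases "a = i") (simp_all add: mult.commute)
    qed
    finally show "c \<preceq> Phi_CI T \<nu> f h g x \<longleftrightarrow> c \<preceq> eval_poly p x * star T \<nu> (eval_poly q x)"
      unfolding Phi nu_le_mult_star by blast
  qed
  have "is_fraction T \<nu> (Phi_CI T \<nu> f h g) p q"
    using p(1) q(1) nu_Phi by (simp add: is_fraction_def tangible_poly_def)
  moreover have "ghost_roots T G (\<lambda>x. eval_poly q x + eval_poly p x)
      \<subseteq> kernel_roots \<nu> (Phi_CI T \<nu> f h g)"
  proof
    fix x assume "x \<in> ghost_roots T G (\<lambda>x. eval_poly q x + eval_poly p x)"
    then have x: "\<And>j. x j \<in> T" and ghost: "eval_poly q x + eval_poly p x \<in> G"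
      by (auto simp: ghost_roots_def)
    have "\<nu> (Phi_CI T \<nu> f h g x) = \<nu> 1"
    \<comment> \<open>If the denominator is at least the numerator, \<open>Phi_CI\<close> is at most
      \<open>1\<close> and hence equivalent to \<open>1\<close>. Otherwise the numerator absorbs the
      denominator and is itself ghost.\<close>
    proof (cases "eval_poly p x \<preceq> eval_poly q x")
      case True
      then have "Phi_CI T \<nu> f h g x \<preceq> 1"
        unfolding nu_le_cong[OF nu_Phi refl] by (simp add: mult_star_nu_le)
      then show ?thesis using one_nu_le_Phi_CI nu_eq_iff by blast
    next
      case False
      then have "eval_poly p x + eval_poly q x = eval_poly p x"
        using absorb nu_le_total by blast
      then have "eval_poly p x \<in> G" using ghost by (simp add: add.commute)
      then have "top_tie (map (\<lambda>v. v * v) (map (\<lambda>m. eval_monom m x) L))"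
        using p(3)[OF x] by (simp add: sq_def comp_def eval_monom_mult)
      then show ?thesis
        unfolding Phi_CI_root_iff_top_tie[OF fr] L_def by (rule top_tie_square)
    qed
    then show "x \<in> kernel_roots \<nu> (Phi_CI T \<nu> f h g)" by (simp add: kernel_roots_def)
  qed
  ultimately show ?thesis unfolding corner_internal_def canonical_def by blast
qed

section \<open>Comparison of the kernel roots of \<open>f\<close> and \<open>Phi_CI\<close>\<close>

text \<open>At a kernel root, \<open>f\<close> and its inverse are equivalent to \<open>1\<close>,
  hence so is \<open>|f|\<close>, and the other factors of the meet are at least
  \<open>1\<close>.\<close>

lemma kernel_roots_subset_Phi_CI:
  "kernel_roots \<nu> f \<subseteq> kernel_roots \<nu> (Phi_CI T \<nu> f h g)"
proof
  fix x assume "x \<in> kernel_roots \<nu> f"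
  then have f: "\<nu> (f x) = \<nu> 1" by (simp add: kernel_roots_def)
  have "c \<preceq> f x \<longleftrightarrow> c \<preceq> 1" "c \<preceq> star T \<nu> (f x) \<longleftrightarrow> c \<preceq> 1" for c
    using f by (auto simp: nu_le_star nu_mult nu_mult_one intro!: nu_le_cong)
  then have "\<nu> (Phi_CI T \<nu> f h g x) = \<nu> 1"
    by (intro nu_eqI) (auto simp: nu_le_Phi_CI)
  then show "x \<in> kernel_roots \<nu> (Phi_CI T \<nu> f h g)" by (simp add: kernel_roots_def)
qed

text \<open>A kernel root of \<open>Phi_CI\<close> is a point with a tie, and a tie makes
  \<open>g + h\<close> ghost. Ghost roots are tangible points whereas \<open>x\<close> may have
  ghost coordinates, so the argument passes through a tangible lift \<open>y\<close> of
  \<open>x\<close>.\<close>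

lemma kernel_roots_Phi_CI_canonical:
  assumes can: "canonical T \<nu> G f h g"
  shows "kernel_roots \<nu> (Phi_CI T \<nu> f h g) \<subseteq> kernel_roots \<nu> f"
proof
  have fr: "is_fraction T \<nu> f h g" using can by (simp add: canonical_def)
  note ne = is_fraction_nonempty[OF fr]
  fix x assume "x \<in> kernel_roots \<nu> (Phi_CI T \<nu> f h g)"
  then have tie: "top_tie (map (\<lambda>m. eval_monom m x) (h @ g))"
    using Phi_CI_root_iff_top_tie[OF fr] by (simp add: kernel_roots_def)
  obtain t where t: "\<And>a. t a \<in> T" "\<And>a. \<nu> (t a) = \<nu> a" using tangible_lift by metis
  define y where "y j = t (x j)" for j
  have y: "y j \<in> T" "\<nu> (y j) = \<nu> (x j)" for j by (simp_all add: y_def t)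
  have cong: "\<nu> (eval_monom m x) = \<nu> (eval_monom m y)" for m
    by (intro eval_monom_cong) (simp_all add: y)
  have "top_tie (map (\<lambda>m. eval_monom m y) (h @ g))"
    by (rule top_tie_cong[OF _ tie]) (simp add: cong)
  then have "eval_poly g y + eval_poly h y \<in> G"
    using top_tie_ghost ne by (metis eval_poly_append eval_poly_def add.commute)
  then have "y \<in> kernel_roots \<nu> f"
    using can y by (auto simp: canonical_def ghost_roots_def)
  moreover have "\<nu> (eval_poly p x) = \<nu> (eval_poly p y)" if "p \<noteq> []" for p
    using that by (intro eval_poly_cong) (simp_all add: cong)
  then have "\<nu> (f x) = \<nu> (f y)"
    unfolding is_fraction_nu[OF fr] nu_mult using ne star_cong by metis
  ultimately show "x \<in> kernel_roots \<nu> f" by (simp add: kernel_roots_def)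
qed

text \<open>
  The fraction \<open>h/g\<close> itself need not be canonical, since a dominant ghost coefficient of \<open>h\<close>
  produces ghost roots; its coefficients have to be lifted first.
\<close>

lemma corner_internal_if_kernel_roots_Phi_CI:
  fixes h g :: "('a, 'n::finite) mpoly"
  assumes fr: "is_fraction T \<nu> f h g"
    and roots: "kernel_roots \<nu> (Phi_CI T \<nu> f h g) \<subseteq> kernel_roots \<nu> f"
  shows "corner_internal T \<nu> G f"
proof -
  note ne = is_fraction_nonempty[OF fr]
  obtain t where t: "\<And>a. t a \<in> T" "\<And>a. \<nu> (t a) = \<nu> a" using tangible_lift by metis
  define h' where "h' = map (\<lambda>m. (t (fst m), snd m)) h"
  have cong: "\<nu> (eval_monom (t (fst m), snd m) x) = \<nu> (eval_monom m x)" for m and x :: "'n \<Rightarrow> 'a"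
    by (rule eval_monom_cong) (simp_all add: t)
  have h'_ne: "h' \<noteq> []" using ne by (simp add: h'_def)
  have eval: "\<nu> (eval_poly h' x) = \<nu> (eval_poly h x)" for x
    using h'_ne by (intro eval_poly_cong) (simp_all add: h'_def cong)
  have fr': "is_fraction T \<nu> f h' g"
    using fr by (simp add: is_fraction_def nu_mult eval) (simp add: is_poly_def h'_def comp_def)
  have "ghost_roots T G (\<lambda>x. eval_poly g x + eval_poly h' x) \<subseteq> kernel_roots \<nu> f"
  proof
    fix x assume "x \<in> ghost_roots T G (\<lambda>x. eval_poly g x + eval_poly h' x)"
    then have x: "\<And>j. x j \<in> T" and "eval_poly g x + eval_poly h' x \<in> G"
      by (auto simp: ghost_roots_def)
    then have "eval_poly (h' @ g) x \<in> G"
      using ne h'_ne by (simp add: eval_poly_append add.commute)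
    moreover have "fst ` set (h' @ g) \<subseteq> T"
      using t fr by (auto simp: h'_def is_fraction_def tangible_poly_def)
    ultimately have "top_tie (map (\<lambda>m. eval_monom m x) (h' @ g))"
      using x h'_ne by (intro tangible_poly_top_tie) auto
    then have "top_tie (map (\<lambda>m. eval_monom m x) (h @ g))"
      by (rule top_tie_cong[rotated]) (simp add: h'_def cong)
    then show "x \<in> kernel_roots \<nu> f"
      using Phi_CI_root_iff_top_tie[OF fr] roots by (auto simp: kernel_roots_def)
  qed
  then show ?thesis using fr' unfolding corner_internal_def canonical_def by blast
qed

end

text \<open>The implication from \<open>corner_internal\<close> to \<open>canonical\<close> in the
  conclusion renders the convention that a corner internal \<open>f\<close> is presented
  canonically; it supplies the assumption of \<open>kernel_roots_Phi_CI_canonical\<close>.\<close>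

theorem theorem7p3p9:
  fixes T G :: "'a::{comm_semiring,comm_monoid_mult} set"
    and \<nu> :: "'a \<Rightarrow> 'a"
    and r :: "('a \<times> 'a) set"
    and f :: "('n::finite \<Rightarrow> 'a) \<Rightarrow> 'a"
    and h g :: "('a, 'n) mpoly"
  assumes "nu_semifield T \<nu> G r"
    and tangible_or_ghost: "T \<union> G = UNIV" "T \<inter> G = {}"
    and natural_order: "\<And>x y. x \<in> G \<Longrightarrow> y \<in> G \<Longrightarrow> (x, y) \<in> r \<longleftrightarrow> x + y = y"
    and "is_fraction T \<nu> f h g"
  shows "corner_internal_kernel T \<nu> G (generated_kernel T \<nu> (Phi_CI T \<nu> f h g))
    \<and> kernel_roots \<nu> f \<subseteq> kernel_roots \<nu> (Phi_CI T \<nu> f h g)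
    \<and> ((corner_internal T \<nu> G f \<longrightarrow> canonical T \<nu> G f h g) \<longrightarrow>
        (kernel_roots \<nu> (Phi_CI T \<nu> f h g) = kernel_roots \<nu> f \<longleftrightarrow> corner_internal T \<nu> G f))"
proof -
  interpret nu_semifield_natural T \<nu> G r
    using assms by (intro nu_semifield_natural.intro nu_semifield_natural_axioms.intro)
  note fr = \<open>is_fraction T \<nu> f h g\<close>
  have ci: "corner_internal T \<nu> G (Phi_CI T \<nu> f h g)" using corner_internal_Phi_CI[OF fr] .
  then have "Phi_CI T \<nu> f h g \<in> rat_funs T \<nu>"
    by (auto simp: corner_internal_def canonical_def rat_funs_def)
  \<comment> \<open>\<open>Phi_CI\<close> itself is the corner internal generator.\<close>
  with ci have "corner_internal_kernel T \<nu> G (generated_kernel T \<nu> (Phi_CI T \<nu> f h g))"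
    unfolding corner_internal_kernel_def by blast
  then show ?thesis
    using kernel_roots_subset_Phi_CI kernel_roots_Phi_CI_canonical
      corner_internal_if_kernel_roots_Phi_CI[OF fr] by blast
qed

end
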